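(* Let $\mathbf{k}$ be a unitary commutative ring, $\Omega$ a nonempty set, and let $(R,\{P_\omega\mid\omega\in\Omega\})$ be a matching Rota-Baxter algebra of weight $\lambda_\Omega=\{\lambda_\omega\mid\omega\in\Omega\}\subseteq\mathbf{k}$. Let $A_i:\Omega\to\mathbf{k}$, $\omega\mapsto a_{i,\omega}$, $i\in I$, be a family of maps with finite supports. For $i\in I$ put $$P_i:=\sum_{\omega\in\Omega}a_{i,\omega}P_\omega .$$ Then $(R,\{P_i\mid i\in I\})$ is a matching Rota-Baxter algebra of weight $\lambda_I:=\{\lambda_i\mid i\in I\}$, where $\lambda_i:=\sum_{\omega\in\Omega}a_{i,\omega}\lambda_\omega$. In particular, each $P_i$ is a Rota-Baxter operator on $R$ of weight $\lambda_i$, so that any (finite) linear combination of the operators $P_\omega$ of a matching Rota-Baxter algebra is a Rota-Baxter operator of a suitable weight.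
   Context: Algebras are associative $\mathbf{k}$-algebras, possibly without unit. Matching Rota-Baxter algebra: given an index set $\Omega$ and a family of scalars $\lambda_\Omega=\{\lambda_\omega\mid\omega\in\Omega\}\subseteq\mathbf{k}$, a matching Rota-Baxter algebra of weight $\lambda_\Omega$ is a pair $(R,\{P_\omega\mid\omega\in\Omega\})$ where $R$ is an associative $\mathbf{k}$-algebra and $P_\omega:R\to R$ are $\mathbf{k}$-linear operators such that $$P_\alpha(x)P_\beta(y)=P_\alpha(xP_\beta(y))+P_\beta(P_\alpha(x)y)+\lambda_\beta P_\alpha(xy)\quad\text{for all }x,y\in R,\ \alpha,\beta\in\Omega .$$ A Rota-Baxter operator of weight $\lambda\in\mathbf{k}$ on $R$ is a linear map $P:R\to R$ with $P(x)P(y)=P(xP(y)+P(x)y+\lambda xy)$ for all $x,y\in R$. *)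

theory Defs
  imports Complex_Main
begin

text \<open>Algebras need not be unital: the class \<^class>\<open>ring\<close> has no unit, whereas the
  scalars form a commutative ring with unit.\<close>

locale assoc_algebra = module scale
  for scale :: "'k::comm_ring_1 \<Rightarrow> 'r::ring \<Rightarrow> 'r" (infixr \<open>*s\<close> 75) +
  assumes scale_mult_left: "(c *s x) * y = c *s (x * y)"
    and scale_mult_right: "x * (c *s y) = c *s (x * y)"

locale rota_baxter_operator = assoc_algebra scale
  for scale :: "'k::comm_ring_1 \<Rightarrow> 'r::ring \<Rightarrow> 'r" (infixr \<open>*s\<close> 75) +
  fixes wt :: 'k and P :: "'r \<Rightarrow> 'r"
  assumes linear: "module_hom scale scale P"
    and rota_baxter: "P x * P y = P (x * P y + P x * y + wt *s (x * y))"

locale matching_rota_baxter_algebra = assoc_algebra scale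
  for scale :: "'k::comm_ring_1 \<Rightarrow> 'r::ring \<Rightarrow> 'r" (infixr \<open>*s\<close> 75) +
  fixes \<Omega> :: "'w set" and wt :: "'w \<Rightarrow> 'k" and P :: "'w \<Rightarrow> 'r \<Rightarrow> 'r"
  assumes linear: "\<omega> \<in> \<Omega> \<Longrightarrow> module_hom scale scale (P \<omega>)"
    and matching_rota_baxter:
      "\<lbrakk>\<alpha> \<in> \<Omega>; \<beta> \<in> \<Omega>\<rbrakk> \<Longrightarrow>
        P \<alpha> x * P \<beta> y = P \<alpha> (x * P \<beta> y) + P \<beta> (P \<alpha> x * y) + wt \<beta> *s P \<alpha> (x * y)"

definition supp_on :: "'w set \<Rightarrow> ('w \<Rightarrow> 'k::zero) \<Rightarrow> 'w set"
  where "supp_on \<Omega> a = {\<omega> \<in> \<Omega>. a \<omega> \<noteq> 0}"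

text \<open>For \<open>a\<close> of finite support, the sums over all of \<open>\<Omega>\<close> are taken over the support,
  since \<^const>\<open>sum\<close> is \<open>0\<close> on infinite index sets.\<close>

definition comb_op ::
    "('k::comm_ring_1 \<Rightarrow> 'r::ring \<Rightarrow> 'r) \<Rightarrow> 'w set \<Rightarrow> ('w \<Rightarrow> 'r \<Rightarrow> 'r) \<Rightarrow> ('w \<Rightarrow> 'k) \<Rightarrow> 'r \<Rightarrow> 'r"
  where "comb_op scale \<Omega> P a x = (\<Sum>\<omega>\<in>supp_on \<Omega> a. scale (a \<omega>) (P \<omega> x))"

definition comb_weight :: "'w set \<Rightarrow> ('w \<Rightarrow> 'k::comm_ring_1) \<Rightarrow> ('w \<Rightarrow> 'k) \<Rightarrow> 'k"
  where "comb_weight \<Omega> wt a = (\<Sum>\<omega>\<in>supp_on \<Omega> a. a \<omega> * wt \<omega>)"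

end

theory Submission imports Defs begin

text \<open>The matching identity is bilinear in the pair \<open>(P \<alpha>, P \<beta>)\<close>, except that its weight
  term carries \<open>wt \<beta>\<close>. Weighting it by \<open>a \<alpha> * b \<beta>\<close> and summing collects the weight terms
  into \<open>(\<Sum>\<beta>. b \<beta> * wt \<beta>)\<close> times the \<open>a\<close>-combination.
  The diagonal of a matching identity is the Rota-Baxter identity.\<close>

context matching_rota_baxter_algebra
begin

text \<open>Two independent index sets are kept because two members of the family have different
  supports in general. Each term on the right expands to a double sum with the common coefficients
  \<open>a \<alpha> * b \<beta>\<close>.\<close>

lemma sum_scale_mult:
  assumes A: "A \<subseteq> \<Omega>" and B: "B \<subseteq> \<Omega>"
  shows "(\<Sum>\<alpha>\<in>A. a \<alpha> *s P \<alpha> x) * (\<Sum>\<beta>\<in>B. b \<beta> *s P \<beta> y) =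
      (\<Sum>\<alpha>\<in>A. a \<alpha> *s P \<alpha> (x * (\<Sum>\<beta>\<in>B. b \<beta> *s P \<beta> y)))
    + (\<Sum>\<beta>\<in>B. b \<beta> *s P \<beta> ((\<Sum>\<alpha>\<in>A. a \<alpha> *s P \<alpha> x) * y))
    + (\<Sum>\<beta>\<in>B. b \<beta> * wt \<beta>) *s (\<Sum>\<alpha>\<in>A. a \<alpha> *s P \<alpha> (x * y))"
proof -
  have 1: "a \<alpha> *s P \<alpha> (x * (\<Sum>\<beta>\<in>B. b \<beta> *s P \<beta> y))
      = (\<Sum>\<beta>\<in>B. (a \<alpha> * b \<beta>) *s P \<alpha> (x * P \<beta> y))" if "\<alpha> \<in> A" for \<alpha>
  proof -
    interpret h: module_hom scale scale "P \<alpha>" using linear A that by blast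
    show ?thesis
      by (simp add: sum_distrib_left scale_mult_right h.sum h.scale scale_sum_right)
  qed
  have 2: "b \<beta> *s P \<beta> ((\<Sum>\<alpha>\<in>A. a \<alpha> *s P \<alpha> x) * y)
      = (\<Sum>\<alpha>\<in>A. (a \<alpha> * b \<beta>) *s P \<beta> (P \<alpha> x * y))" if "\<beta> \<in> B" for \<beta>
  proof -
    interpret h: module_hom scale scale "P \<beta>" using linear B that by blast
    show ?thesis
      by (simp add: sum_distrib_right scale_mult_left h.sum h.scale scale_sum_right mult.commute)
  qed
  \<comment> \<open>The factor \<open>wt \<beta>\<close> stays a separate scalar, the form that
    arises when \<open>a \<alpha> * b \<beta>\<close> is distributed over the matching
    identity.\<close>
  have 3: "(\<Sum>\<beta>\<in>B. b \<beta> * wt \<beta>) *s (\<Sum>\<alpha>\<in>A. a \<alpha> *s P \<alpha> (x * y))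
      = (\<Sum>\<alpha>\<in>A. \<Sum>\<beta>\<in>B. (a \<alpha> * b \<beta>) *s wt \<beta> *s P \<alpha> (x * y))"
    by (simp add: scale_sum_right scale_sum_left sum_distrib_left mult_ac)
  have "(\<Sum>\<alpha>\<in>A. a \<alpha> *s P \<alpha> x) * (\<Sum>\<beta>\<in>B. b \<beta> *s P \<beta> y)
      = (\<Sum>\<alpha>\<in>A. \<Sum>\<beta>\<in>B. (a \<alpha> * b \<beta>) *s (P \<alpha> x * P \<beta> y))"
    by (simp add: sum_product scale_mult_left scale_mult_right mult.commute)
  also have "\<dots> = (\<Sum>\<alpha>\<in>A. \<Sum>\<beta>\<in>B. (a \<alpha> * b \<beta>) *s P \<alpha> (x * P \<beta> y)
      + (a \<alpha> * b \<beta>) *s P \<beta> (P \<alpha> x * y) + (a \<alpha> * b \<beta>) *s wt \<beta> *s P \<alpha> (x * y))"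
    by (intro sum.cong refl, subst matching_rota_baxter)
      (use A B in \<open>auto simp: scale_right_distrib\<close>)
  also have "\<dots> = (\<Sum>\<alpha>\<in>A. \<Sum>\<beta>\<in>B. (a \<alpha> * b \<beta>) *s P \<alpha> (x * P \<beta> y))
      + (\<Sum>\<beta>\<in>B. \<Sum>\<alpha>\<in>A. (a \<alpha> * b \<beta>) *s P \<beta> (P \<alpha> x * y))
      + (\<Sum>\<alpha>\<in>A. \<Sum>\<beta>\<in>B. (a \<alpha> * b \<beta>) *s wt \<beta> *s P \<alpha> (x * y))"
    \<comment> \<open>The order of summation changes for the middle term, so that
      \<open>P \<beta>\<close> is fixed in the inner sum as in fact \<open>2\<close>.\<close>
    by (simp only: sum.distrib sum.swap[of _ B A])
  finally show ?thesis
    by (simp only: 1 2 3 cong: sum.cong)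
qed

lemma module_hom_comb_op: "module_hom scale scale (comb_op scale \<Omega> P a)"
proof
  fix x y c
  have h: "module_hom scale scale (P \<omega>)" if "\<omega> \<in> supp_on \<Omega> a" for \<omega>
    using that linear by (simp add: supp_on_def)
  show "comb_op scale \<Omega> P a (x + y) = comb_op scale \<Omega> P a x + comb_op scale \<Omega> P a y"
    by (simp add: comb_op_def module_hom.add[OF h] scale_right_distrib sum.distrib)
  show "comb_op scale \<Omega> P a (c *s x) = c *s comb_op scale \<Omega> P a x"
    by (simp add: comb_op_def module_hom.scale[OF h] scale_sum_right mult.commute)
qed

text \<open>The bilinear identity is applied to the supports of \<open>a i\<close> and
  \<open>a j\<close>. Leaving \<open>I\<close> and \<open>a\<close> general lets the result serve
  again for a family with a single member.\<close>

lemma matching_rota_baxter_algebra_comb_op: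
  "matching_rota_baxter_algebra scale I
     (\<lambda>i. comb_weight \<Omega> wt (a i)) (\<lambda>i. comb_op scale \<Omega> P (a i))"
proof (intro matching_rota_baxter_algebra.intro assoc_algebra_axioms
    matching_rota_baxter_algebra_axioms.intro)
  show "module_hom scale scale (comb_op scale \<Omega> P (a i))" for i
    by (rule module_hom_comb_op)
  show "comb_op scale \<Omega> P (a i) x * comb_op scale \<Omega> P (a j) y =
      comb_op scale \<Omega> P (a i) (x * comb_op scale \<Omega> P (a j) y)
    + comb_op scale \<Omega> P (a j) (comb_op scale \<Omega> P (a i) x * y)
    + comb_weight \<Omega> wt (a j) *s comb_op scale \<Omega> P (a i) (x * y)" for i j x y
    unfolding comb_op_def comb_weight_def
    by (rule sum_scale_mult) (auto simp: supp_on_def)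
qed

lemma rota_baxter_operator:
  assumes "\<omega> \<in> \<Omega>"
  shows "rota_baxter_operator scale (wt \<omega>) (P \<omega>)"
proof -
  interpret h: module_hom scale scale "P \<omega>" by (rule linear[OF assms])
  show ?thesis
    \<comment> \<open>For \<alpha> = \<beta> all three terms are values of the same linear map, so
      they merge into one value and the weight moves inside.\<close>
    by unfold_locales (simp add: matching_rota_baxter[OF assms assms] h.add h.scale)
qed

text \<open>Extending \<open>c\<close> by zero puts the support inside \<open>F\<close>. It may be
  smaller than \<open>F\<close>, but the indices left out have coefficient 0 and contribute
  nothing.\<close>

lemma sum_scale_eq_comb_op:
  assumes "finite F" and "F \<subseteq> \<Omega>"
  shows "(\<lambda>x. \<Sum>\<omega>\<in>F. c \<omega> *s P \<omega> x) = comb_op scale \<Omega> P (\<lambda>\<omega>. if \<omega> \<in> F then c \<omega> else 0)"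
  unfolding comb_op_def
  by (intro ext sum.mono_neutral_cong_right) (use assms in \<open>auto simp: supp_on_def\<close>)

end

theorem proposition2p5:
  fixes scale :: "'k::comm_ring_1 \<Rightarrow> 'r::ring \<Rightarrow> 'r"
    and \<Omega> :: "'w set" and wt :: "'w \<Rightarrow> 'k" and P :: "'w \<Rightarrow> 'r \<Rightarrow> 'r"
    and I :: "'i set" and a :: "'i \<Rightarrow> 'w \<Rightarrow> 'k"
  assumes "\<Omega> \<noteq> {}"
    and "matching_rota_baxter_algebra scale \<Omega> wt P"
    and "\<And>i. i \<in> I \<Longrightarrow> finite (supp_on \<Omega> (a i))"
  shows "matching_rota_baxter_algebra scale I
           (\<lambda>i. comb_weight \<Omega> wt (a i)) (\<lambda>i. comb_op scale \<Omega> P (a i))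
       \<and> (\<forall>i\<in>I. rota_baxter_operator scale (comb_weight \<Omega> wt (a i)) (comb_op scale \<Omega> P (a i)))
       \<and> (\<forall>F c. finite F \<and> F \<subseteq> \<Omega> \<longrightarrow>
            (\<exists>\<mu>. rota_baxter_operator scale \<mu> (\<lambda>x. \<Sum>\<omega>\<in>F. scale (c \<omega>) (P \<omega> x))))"
proof -
  interpret matching_rota_baxter_algebra scale \<Omega> wt P by fact
  \<comment> \<open>A single map \<open>b\<close> is viewed as a constant family over the
    one-element type \<open>unit\<close>; the diagonal of its matching identity is the
    claim.\<close>
  have rb: "rota_baxter_operator scale (comb_weight \<Omega> wt b) (comb_op scale \<Omega> P b)" for b
    using matching_rota_baxter_algebra.rota_baxter_operator
      [OF matching_rota_baxter_algebra_comb_op[of UNIV "\<lambda>_::unit. b"]] by simp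
  have "\<exists>\<mu>. rota_baxter_operator scale \<mu> (\<lambda>x. \<Sum>\<omega>\<in>F. scale (c \<omega>) (P \<omega> x))"
    if "finite F" "F \<subseteq> \<Omega>" for F c
    \<comment> \<open>The witness for \<mu> is the combined weight of the zero extension of
      \<open>c\<close>, that is, the sum of \<open>c \<omega> * wt \<omega>\<close> over
      \<open>F\<close>.\<close>
    unfolding sum_scale_eq_comb_op[OF that] using rb by blast
  with matching_rota_baxter_algebra_comb_op rb show ?thesis by blast
qed

end
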